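(* For all integers $m\geq 0$ and $n\geq 1$, \[ q(m,n)\geq p(-m+1,n). \]
   Context: For a partition $\lambda$, $\operatorname{rank}(\lambda)$ is its largest part minus its number of parts. $p(m,n)$ is the number of partitions of $n$ with rank at least $m$. For a partition $\lambda=(\lambda_1\geq\cdots\geq\lambda_\ell)$, its rank-set is the infinite sequence $[-\lambda_1,1-\lambda_2,\ldots,j-\lambda_{j+1},\ldots,\ell-1-\lambda_\ell,\ell,\ell+1,\ldots]$. Then $q(m,n)$ is the number of partitions of $n$ whose rank-set contains $m$. *)

theory Defs
  imports Main
begin

definition partitions :: "nat \<Rightarrow> nat list set" where
  "partitions n = {xs. sorted_wrt (\<ge>) xs \<and> (\<forall>x\<in>set xs. 0 < x) \<and> sum_list xs = n}"

definition prank :: "nat list \<Rightarrow> int" where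
  "prank xs = (if xs = [] then 0 else int (hd xs) - int (length xs))"

text \<open>The rank-set [-lambda_1, 1 - lambda_2, ..., l-1-lambda_l, l, l+1, ...]:
its j-th entry (j >= 0) is j - lambda_{j+1} for j < l and j for j >= l.\<close>

definition rank_set_entry :: "nat list \<Rightarrow> nat \<Rightarrow> int" where
  "rank_set_entry xs j = (if j < length xs then int j - int (xs ! j) else int j)"

definition in_rank_set :: "int \<Rightarrow> nat list \<Rightarrow> bool" where
  "in_rank_set m xs \<longleftrightarrow> (\<exists>j. rank_set_entry xs j = m)"

definition p_rank :: "int \<Rightarrow> nat \<Rightarrow> nat" where
  "p_rank m n = card {xs \<in> partitions n. prank xs \<ge> m}"

definition q_rank :: "int \<Rightarrow> nat \<Rightarrow> nat" where
  "q_rank m n = card {xs \<in> partitions n. in_rank_set m xs}"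

end

theory Submission
  imports Defs
begin

text \<open>
  Passing to complements, one has to inject the partitions whose rank-set omits \<open>m\<close> into those
  of rank at most \<open>-m\<close>. Partitions in both sets are fixed. If the rank-set omits \<open>m\<close>, then for
  some \<open>h\<close> exactly the first \<open>h + m + 1\<close> parts exceed \<open>h\<close>; let \<open>a\<close> be the largest part, \<open>us\<close> the
  other parts exceeding \<open>h\<close>, and \<open>vs\<close> the remaining ones. If the rank exceeds \<open>-m\<close>, then
  \<open>a > h + 1 + length vs\<close>, and one takes \<open>a\<close> out and puts it back below \<open>us\<close> as a hook with
  corner \<open>K\<close>: a new row of length \<open>K\<close> and a new column of height \<open>a - K\<close> under it. The corner is
  \<open>h + 1\<close> if \<open>vs\<close> (padded with zeros) contains \<open>h\<close>, and \<open>h\<close> otherwise. In either case the part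
  with (0-based) index \<open>K + m\<close> equals \<open>K\<close>, so that \<open>m\<close> is in the new rank-set and determines \<open>K\<close>;
  the preceding part equals \<open>K\<close> in the first case only.
\<close>

definition part :: "nat list \<Rightarrow> nat \<Rightarrow> nat" where
  "part xs j = (if j < length xs then xs ! j else 0)"

lemma rank_set_entry_part: "rank_set_entry xs j = int j - int (part xs j)"
  by (simp add: rank_set_entry_def part_def)

lemma part_antimono:
  assumes "sorted_wrt (\<ge>) xs" and "i \<le> j"
  shows "part xs j \<le> part xs i"
  using sorted_wrt_nth_less[OF assms(1), of i j] assms(2)
  by (cases "i = j") (auto simp: part_def)

lemma finite_partitions: "finite (partitions n)"
proof (rule finite_subset)
  show "partitions n \<subseteq> {xs. set xs \<subseteq> {..n} \<and> length xs \<le> n}"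
  proof
    fix xs assume "xs \<in> partitions n"
    then have pos: "\<forall>x\<in>set xs. 0 < x" and sum: "sum_list xs = n"
      by (auto simp: partitions_def)
    have "length xs \<le> sum_list xs"
      using pos by (induction xs) auto
    then show "xs \<in> {xs. set xs \<subseteq> {..n} \<and> length xs \<le> n}"
      using sum member_le_sum_list[of _ xs] by auto
  qed
qed (simp add: finite_lists_length_le)

definition split_at :: "nat \<Rightarrow> nat \<Rightarrow> nat list \<Rightarrow> nat list \<Rightarrow> bool" where
  "split_at m h us vs \<longleftrightarrow>
     length us = h + m \<and> (\<forall>x\<in>set us. h < x) \<and> (\<forall>x\<in>set vs. 0 < x \<and> x \<le> h)"

text \<open>The padding puts \<open>h = 0\<close> into the first case, so the corner is always
  positive.\<close>

definition corner :: "nat \<Rightarrow> nat list \<Rightarrow> nat" where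
  "corner h vs = (if h \<in> set (vs @ [0]) then Suc h else h)"

text \<open>For \<open>a\<close> large enough, the column of height \<open>a - corner h vs\<close>
  adds one cell to each part of \<open>vs\<close>; its remaining cells become new parts 1.\<close>

definition move_hook :: "nat \<Rightarrow> nat \<Rightarrow> nat list \<Rightarrow> nat list \<Rightarrow> nat list" where
  "move_hook h a us vs =
     us @ corner h vs # map Suc vs @ replicate (a - corner h vs - length vs) 1"

text \<open>Let \<open>J = h + m + 1\<close> be the first index whose rank-set entry exceeds
  \<open>m\<close>; the part there is at most \<open>h\<close>. The entry just before is at most
  \<open>m\<close>, hence smaller than \<open>m\<close> by omission, so its part exceeds
  \<open>h\<close>.\<close>

lemma split_of_not_in_rank_set:
  assumes xs: "xs \<in> partitions n" and "xs \<noteq> []" and "\<not> in_rank_set (int m) xs"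
  shows "\<exists>h a us vs. xs = a # us @ vs \<and> split_at m h us vs"
proof -
  have sorted: "sorted_wrt (\<ge>) xs" and pos: "\<forall>x\<in>set xs. 0 < x"
    using xs by (auto simp: partitions_def)
  have neq: "int j - int (part xs j) \<noteq> int m" for j
    using assms(3) by (auto simp: in_rank_set_def rank_set_entry_part)
  define J where "J = (LEAST j. m + part xs j < j)"
  have "m + part xs (length xs + m + 1) < length xs + m + 1"
    by (simp add: part_def)
  then have J: "m + part xs J < J"
    unfolding J_def by (rule LeastI)
  then have "J = Suc ((J - Suc m) + m)"
    by simp
  then obtain h where h: "J = Suc (h + m)"
    by blast
  have "\<not> m + part xs (h + m) < h + m"
    using not_less_Least[of "h + m" "\<lambda>j. m + part xs j < j"] h by (simp add: J_def)
  then have ge: "h < part xs (h + m)"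
    using neq[of "h + m"] by linarith
  then have len: "h + m < length xs"
    by (auto simp: part_def split: if_splits)
  have le: "part xs J \<le> h"
    using J h by simp
  obtain a ys where ays: "xs = a # ys"
    using \<open>xs \<noteq> []\<close> by (cases xs) auto
  define us vs where "us = take (h + m) ys" and "vs = drop (h + m) ys"
  have "h < x" if "x \<in> set us" for x
  proof -
    obtain i where "i < h + m" "i < length ys" "x = ys ! i"
      using \<open>x \<in> set us\<close> by (auto simp: us_def in_set_conv_nth)
    then have "x = part xs (Suc i)" "Suc i \<le> h + m"
      by (auto simp: ays part_def)
    then show ?thesis
      using part_antimono[OF sorted, of "Suc i" "h + m"] ge by simp
  qed
  moreover have "x \<le> h" if "x \<in> set vs" for x
  proof -
    obtain i where "i < length vs" "x = vs ! i"
      using \<open>x \<in> set vs\<close> by (auto simp: in_set_conv_nth)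
    then have "h + m + i < length ys" "x = ys ! (h + m + i)"
      by (simp_all add: vs_def)
    then have "x = part xs (J + i)"
      by (simp add: ays part_def h)
    then show ?thesis
      using part_antimono[OF sorted, of J "J + i"] le by simp
  qed
  moreover have "0 < x" if "x \<in> set vs" for x
    using that pos by (auto simp: ays vs_def dest: in_set_dropD)
  moreover have "length us = h + m" "xs = a # us @ vs"
    using len by (auto simp: ays us_def vs_def)
  ultimately show ?thesis
    unfolding split_at_def by blast
qed

lemma corner_hook_entries:
  assumes split: "split_at m h us vs" and a: "Suc h + length vs < a"
    and sorted: "sorted_wrt (\<ge>) (a # us @ vs)"
  defines "K \<equiv> corner h vs" and "ys \<equiv> move_hook h a us vs"
  shows "0 < K" and "part ys (K + m) = K" and "h = K \<longleftrightarrow> part ys (K + m - 1) \<noteq> K"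
proof -
  show K0: "0 < K"
    by (auto simp: K_def corner_def)
  have len: "length us = h + m" and us: "\<forall>x\<in>set us. h < x" and vs: "\<forall>x\<in>set vs. 0 < x \<and> x \<le> h"
    using split by (auto simp: split_at_def)
  have at: "part ys (h + m) = K"
    by (simp add: part_def ys_def move_hook_def K_def len nth_append)
  have "part ys (K + m) = K \<and> (h = K \<longleftrightarrow> part ys (K + m - 1) \<noteq> K)"
  proof (cases "h \<in> set (vs @ [0])")
    case True
    then have K: "K = Suc h"
      by (simp add: K_def corner_def)
    \<comment> \<open>The part after the corner is the head of \<open>vs\<close> plus 1. If
      \<open>vs\<close> is empty, then \<open>h = 0\<close> and it is the first new 1, which exists
      because \<open>a > 1\<close>.\<close>
    have "part ys (Suc h + m) = Suc h"
    proof (cases vs)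
      case Nil
      with True a show ?thesis
        by (auto simp: part_def ys_def move_hook_def len nth_append corner_def)
    next
      case (Cons v ws)
      have "v = h"
        using True vs sorted by (force simp: Cons sorted_wrt_append)
      then show ?thesis
        by (simp add: part_def ys_def move_hook_def len nth_append Cons)
    qed
    then show ?thesis
      using at K by simp
  next
    case False
    then have K: "K = h"
      by (simp add: K_def corner_def)
    \<comment> \<open>Here \<open>h = K\<close> is positive, so \<open>us\<close> is nonempty and
      its last part precedes the corner.\<close>
    then have last: "h + m - 1 < length us"
      using K0 len by simp
    then have "part ys (h + m - 1) = us ! (h + m - 1)"
      by (simp add: part_def ys_def move_hook_def nth_append_left)
    moreover have "h < us ! (h + m - 1)"
      using us last by simp
    ultimately show ?thesis
      using at K by simp
  qed
  then show "part ys (K + m) = K" and "h = K \<longleftrightarrow> part ys (K + m - 1) \<noteq> K"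
    by blast+
qed

lemma move_hook_partition:
  assumes split: "split_at m h us vs" and a: "Suc h + length vs < a"
    and xs: "a # us @ vs \<in> partitions n"
  shows "move_hook h a us vs \<in> partitions n"
    and "in_rank_set (int m) (move_hook h a us vs)"
    and "prank (move_hook h a us vs) \<le> - int m"
proof -
  define K where "K = corner h vs"
  have len: "length us = h + m" and us: "\<forall>x\<in>set us. h < x" and vs: "\<forall>x\<in>set vs. 0 < x \<and> x \<le> h"
    using split by (auto simp: split_at_def)
  have sorted: "sorted_wrt (\<ge>) (a # us @ vs)" and sum: "sum_list (a # us @ vs) = n"
    using xs by (auto simp: partitions_def)
  note entries = corner_hook_entries[OF split a sorted, folded K_def]
  \<comment> \<open>The strict bound on \<open>vs\<close> leaves room for the column cell in each
    row. It is the reason for raising the corner to \<open>h + 1\<close> when \<open>h\<close>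
    occurs in \<open>vs\<close>.\<close>
  have K: "K \<le> Suc h" "0 < K" "\<forall>x\<in>set vs. x < K"
    using vs entries(1) by (auto simp: K_def corner_def le_less)
  have eq: "move_hook h a us vs = us @ K # map Suc vs @ replicate (a - K - length vs) 1"
    by (simp add: move_hook_def K_def)
  have "sorted_wrt (\<ge>) (move_hook h a us vs)"
  proof -
    have "sorted_wrt (\<ge>) (map Suc vs)"
      using sorted by (simp add: sorted_wrt_append sorted_wrt_map)
    moreover have "sorted_wrt (\<ge>) (replicate r (1::nat))" for r
      by (induction r) auto
    moreover have "\<forall>x\<in>set us. \<forall>y\<in>set vs. Suc y \<le> x"
      using us vs by (meson Suc_leI le_less_trans)
    moreover have "\<forall>x\<in>set us. K \<le> x \<and> 1 \<le> x"
      using us K by fastforce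
    moreover have "\<forall>y\<in>set vs. Suc y \<le> K"
      using K by (simp add: Suc_le_eq)
    ultimately show ?thesis
      using sorted K(2) by (fastforce simp: eq sorted_wrt_append)
  qed
  moreover have "sum_list (map Suc vs) = sum_list vs + length vs"
    by (induction vs) auto
  then have "sum_list (move_hook h a us vs) = n"
    using sum a K by (simp add: eq sum_list_replicate)
  ultimately show "move_hook h a us vs \<in> partitions n"
    using us K by (fastforce simp: partitions_def eq)
  show "in_rank_set (int m) (move_hook h a us vs)"
    unfolding in_rank_set_def rank_set_entry_part
    using entries(2) by (intro exI[of _ "K + m"]) simp
  have "hd (move_hook h a us vs) \<le> a"
    unfolding eq using sorted a K by (cases us) auto
  \<comment> \<open>The length is \<open>(h + m) + 1 + (a - K)\<close>, and \<open>K\<close> is at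
    most \<open>h + 1\<close>.\<close>
  moreover have "a + m \<le> length (move_hook h a us vs)"
    using a K by (simp add: eq len)
  ultimately show "prank (move_hook h a us vs) \<le> - int m"
    by (auto simp: prank_def)
qed

text \<open>The image is decoded in the order \<open>K\<close>, \<open>h\<close>, \<open>us\<close>,
  \<open>vs\<close>, \<open>a\<close>.\<close>

lemma move_hook_inj:
  assumes split: "split_at m h us vs" "split_at m h' us' vs'"
    and a: "Suc h + length vs < a" "Suc h' + length vs' < a'"
    and sorted: "sorted_wrt (\<ge>) (a # us @ vs)" "sorted_wrt (\<ge>) (a' # us' @ vs')"
    and ys_sorted: "sorted_wrt (\<ge>) (move_hook h a us vs)"
    and eq: "move_hook h a us vs = move_hook h' a' us' vs'"
  shows "a # us @ vs = a' # us' @ vs'"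
proof -
  let ?ys = "move_hook h a us vs"
  define K K' where "K = corner h vs" and "K' = corner h' vs'"
  note e = corner_hook_entries[OF split(1) a(1) sorted(1), folded K_def]
  note e' = corner_hook_entries[OF split(2) a(2) sorted(2), folded K'_def eq]
  \<comment> \<open>The sequence \<open>j - part ys j\<close> is strictly increasing, so it takes
    the value \<open>m\<close> only once.\<close>
  have KK': "K = K'"
  proof (cases K K' rule: linorder_cases)
    case less
    then show ?thesis
      using part_antimono[OF ys_sorted, of "K + m" "K' + m"] e(2) e'(2) by simp
  next
    case greater
    then show ?thesis
      using part_antimono[OF ys_sorted, of "K' + m" "K + m"] e(2) e'(2) by simp
  qed simp
  have "h = K \<or> Suc h = K" "h' = K' \<or> Suc h' = K'"
    by (auto simp: K_def K'_def corner_def)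
  then have hh': "h = h'"
    using e(3) e'(3) KK' by auto
  define W where "W = map Suc vs @ replicate (a - K - length vs) 1"
  define W' where "W' = map Suc vs' @ replicate (a' - K' - length vs') 1"
  have "length us = length us'"
    using split hh' by (simp add: split_at_def)
  moreover have "us @ K # W = us' @ K' # W'"
    using eq by (simp add: move_hook_def K_def K'_def W_def W'_def)
  ultimately have us: "us = us'" and WW': "W = W'"
    by simp_all
  have pos: "0 \<notin> set vs" "0 \<notin> set vs'"
    using split by (auto simp: split_at_def)
  \<comment> \<open>Taking the column off turns the new parts 1 into zeros, which cannot be confused
    with parts of \<open>vs\<close>.\<close>
  have strip: "filter (\<lambda>x. x \<noteq> 0) (map (\<lambda>x. x - 1) (map Suc zs @ replicate r 1)) = zs"
    if "0 \<notin> set zs" for zs r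
    using that by (induction zs) (auto simp: filter_replicate)
  have vs: "vs = vs'"
    using strip[OF pos(1), of "a - K - length vs"] strip[OF pos(2), of "a' - K' - length vs'"] WW'
    by (simp only: W_def W'_def)
  have "K \<le> Suc h" "K' \<le> Suc h'"
    by (auto simp: K_def K'_def corner_def)
  \<comment> \<open>The number of parts below the corner is the height of the column, which gives
    back \<open>a\<close>.\<close>
  then have "length W = a - K" "length W' = a' - K'" "K < a" "K' < a'"
    using a by (auto simp: W_def W'_def)
  then have "a = a'"
    using WW' KK' by simp
  then show ?thesis
    using us vs by simp
qed

lemma card_not_in_rank_set_le:
  assumes "n \<ge> 1"
  shows "card {xs \<in> partitions n. \<not> in_rank_set (int m) xs}
       \<le> card {xs \<in> partitions n. prank xs \<le> - int m}" (is "card ?Q \<le> card ?R")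
proof -
  \<comment> \<open>A relation avoids having to choose one decomposition of \<open>xs\<close> or to
    prove it unique.\<close>
  define rel where "rel xs ys \<longleftrightarrow> (\<exists>h a us vs. xs = a # us @ vs \<and> split_at m h us vs
    \<and> Suc h + length vs < a \<and> ys = move_hook h a us vs)" for xs ys
  have fin: "finite ?Q" "finite ?R"
    using finite_partitions by auto
  have "card (?Q - ?R) \<le> card (?R - ?Q)"
  proof (rule card_le_if_inj_on_rel[where r = rel])
    fix xs assume xs: "xs \<in> ?Q - ?R"
    then have "xs \<noteq> []"
      using assms by (auto simp: partitions_def)
    then obtain h a us vs where *: "xs = a # us @ vs" "split_at m h us vs"
      using split_of_not_in_rank_set[of xs n m] xs by blast
    \<comment> \<open>This is rank above \<open>-m\<close>, since \<open>xs\<close> has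
      \<open>h + m + 1 + length vs\<close> parts.\<close>
    have a: "Suc h + length vs < a"
      using xs * by (auto simp: prank_def split_at_def)
    show "\<exists>ys. ys \<in> ?R - ?Q \<and> rel xs ys"
      using move_hook_partition[OF *(2) a, of n] xs * a by (auto simp: rel_def)
  next
    fix xs xs' ys
    assume xs: "xs \<in> ?Q - ?R" "xs' \<in> ?Q - ?R" "ys \<in> ?R - ?Q" and "rel xs ys" "rel xs' ys"
    then obtain h a us vs h' a' us' vs' where
        1: "xs = a # us @ vs" "split_at m h us vs" "Suc h + length vs < a"
          "ys = move_hook h a us vs" and
        2: "xs' = a' # us' @ vs'" "split_at m h' us' vs'" "Suc h' + length vs' < a'"
          "ys = move_hook h' a' us' vs'"
      unfolding rel_def by blast
    show "xs = xs'"
      unfolding 1(1) 2(1)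
      by (rule move_hook_inj[OF 1(2) 2(2) 1(3) 2(3)])
        (use xs 1(1) 2(1) 1(4) 2(4) in \<open>simp_all add: partitions_def\<close>)
  qed (use fin(2) in simp)
  then show ?thesis
    using card_Int_Diff[OF fin(1), of ?R] card_Int_Diff[OF fin(2), of ?Q] Int_commute[of ?Q ?R]
    by presburger
qed

theorem theorem2p2:
  fixes m :: int and n :: nat
  assumes "m \<ge> 0" and "n \<ge> 1"
  shows "q_rank m n \<ge> p_rank (- m + 1) n"
proof -
  obtain k where k: "m = int k"
    using assms(1) nonneg_int_cases by blast
  have compl: "card {xs \<in> partitions n. P xs} + card {xs \<in> partitions n. \<not> P xs}
      = card (partitions n)" for P
    using finite_partitions[of n]
    by (subst card_Un_disjoint[symmetric]) (auto intro: arg_cong[where f = card])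
  have "{xs \<in> partitions n. \<not> prank xs \<ge> - m + 1} = {xs \<in> partitions n. prank xs \<le> - int k}"
    using k by auto
  then show ?thesis
    using card_not_in_rank_set_le[OF assms(2), of k] k
      compl[of "in_rank_set m"] compl[of "\<lambda>xs. prank xs \<ge> - m + 1"]
    by (simp add: q_rank_def p_rank_def)
qed

end
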